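(* Let $D$ be a non-zero $n\times n$ generalized Euclidean distance matrix. Then $D^{\dagger}$ is negative semidefinite on $\mathbf{1}^\perp$; that is, $x'D^{\dagger}x\le 0$ for every $x\in\mathbb{R}^n$ with $\mathbf{1}'x=0$.
   Context: All matrices are real; a prime denotes transpose. $\mathbf{1}\in\mathbb{R}^n$ is the vector of all ones, $\mathbf{1}^\perp$ is the subspace of vectors orthogonal to $\mathbf{1}$, and $D^\dagger$ is the Moore-Penrose inverse of $D$. An $n\times n$ real symmetric matrix $L$ is a generalized Laplacian matrix if $L$ is positive semidefinite and $L\mathbf{1}=0$. An $n\times n$ matrix $D=[d_{ij}]$ is a generalized Euclidean distance matrix if there exist real numbers $a,b>0$ and an $n\times n$ generalized Laplacian matrix $L=[l_{ij}]$ such that $d_{ij}=a^2 l_{ii}+b^2 l_{jj}-2ab\,l_{ij}$ for all $i,j$. *)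

theory Defs
  imports "HOL-Analysis.Analysis"
begin

definition positive_semidefinite :: "real^'n^'n \<Rightarrow> bool" where
  "positive_semidefinite A \<longleftrightarrow> (\<forall>x. x \<bullet> (A *v x) \<ge> 0)"

text \<open>In \<^typ>\<open>real^'n\<close> the constant \<open>1\<close> is the vector all of whose entries are one.\<close>

definition generalized_laplacian :: "real^'n^'n \<Rightarrow> bool" where
  "generalized_laplacian L \<longleftrightarrow> transpose L = L \<and> positive_semidefinite L \<and> L *v 1 = 0"

definition generalized_euclidean_distance_matrix :: "real^'n^'n \<Rightarrow> bool" where
  "generalized_euclidean_distance_matrix D \<longleftrightarrow>
    (\<exists>(a::real) (b::real) L. a > 0 \<and> b > 0 \<and> generalized_laplacian L \<and>
      (\<forall>i j. D $ i $ j = a\<^sup>2 * L $ i $ i + b\<^sup>2 * L $ j $ j - 2 * a * b * L $ i $ j))"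

text \<open>The four Penrose equations; \<open>moore_penrose_unique\<close> below shows that they determine
  exactly one matrix, so the definite description in \<open>pinv\<close> is always meaningful.\<close>

definition is_moore_penrose :: "real^'n^'m \<Rightarrow> real^'m^'n \<Rightarrow> bool" where
  "is_moore_penrose A X \<longleftrightarrow>
    A ** X ** A = A \<and> X ** A ** X = X \<and>
    transpose (A ** X) = A ** X \<and> transpose (X ** A) = X ** A"

definition pinv :: "real^'n^'m \<Rightarrow> real^'m^'n" where
  "pinv A = (THE X. is_moore_penrose A X)"

lemma is_moore_penrose_eq:
  assumes X: "is_moore_penrose A X" and Y: "is_moore_penrose A Y"
  shows "X = Y"
proof -
  note x = X[unfolded is_moore_penrose_def] and y = Y[unfolded is_moore_penrose_def]
  have "A ** X = (A ** Y) ** (A ** X)"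
    using y by (simp add: matrix_mul_assoc)
  also have "\<dots> = transpose ((A ** X) ** (A ** Y))"
    using x y by (simp add: matrix_transpose_mul)
  also have "(A ** X) ** (A ** Y) = A ** Y"
    using x by (simp add: matrix_mul_assoc)
  finally have 1: "A ** X = A ** Y" using y by simp
  have "X ** A = (X ** A) ** (Y ** A)"
    using y by (metis matrix_mul_assoc)
  also have "\<dots> = transpose ((Y ** A) ** (X ** A))"
    using x y by (simp add: matrix_transpose_mul)
  also have "(Y ** A) ** (X ** A) = Y ** A"
    using x by (metis matrix_mul_assoc)
  finally have 2: "X ** A = Y ** A" using y by simp
  have "X = X ** A ** X" using x by simp
  also have "\<dots> = Y ** A ** Y" using 1 2 by (metis matrix_mul_assoc)
  finally show ?thesis using y by simp
qed

lemma symmetric_matrixI: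
  fixes M :: "real^'n^'n"
  assumes "\<And>x y. (M *v x) \<bullet> y = x \<bullet> (M *v y)"
  shows "transpose M = M"
proof -
  have "transpose M *v y = M *v y" for y
  proof -
    have "x \<bullet> (transpose M *v y) = x \<bullet> (M *v y)" for x
      using assms[of x y] dot_lmul_matrix[of y M x]
      by (simp add: transpose_matrix_vector inner_commute)
    then show ?thesis using vector_eq_ldot by blast
  qed
  then show ?thesis by (simp add: matrix_eq)
qed

lemma is_moore_penrose_exists:
  fixes A :: "real^'n^'m"
  shows "\<exists>X. is_moore_penrose A X"
proof -
  define W where "W = range (\<lambda>y. transpose A *v y)"
  have W: "subspace W"
    unfolding W_def by (intro linear_subspace_image) auto
  have dot: "(A *v x) \<bullet> y = x \<bullet> (transpose A *v y)" for x y
    by (metis dot_lmul_matrix inner_commute transpose_matrix_vector)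
  have ker: "w \<bullet> z = 0" if "w \<in> W" "A *v z = 0" for w z
    using that unfolding W_def by (metis dot imageE inner_commute inner_zero_left)
  have ex: "\<exists>w\<in>W. \<forall>v. (y - A *v w) \<bullet> (A *v v) = 0" for y
  proof -
    have V: "subspace (range ((*v) A))" by (intro linear_subspace_image) auto
    obtain p q where p: "p \<in> range ((*v) A)" and q: "\<And>v. v \<in> range ((*v) A) \<Longrightarrow> orthogonal q v"
      and y: "y = p + q"
      using orthogonal_subspace_decomp_exists[of "range ((*v) A)" y] V
      by (metis span_eq_iff)
    from p obtain u where u: "p = A *v u" by auto
    obtain w z where w: "w \<in> W" and z: "\<And>v. v \<in> W \<Longrightarrow> orthogonal z v" and uwz: "u = w + z"
      using orthogonal_subspace_decomp_exists[of W u] W by (metis span_eq_iff)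
    have "(A *v z) \<bullet> (A *v z) = 0"
      using z[of "transpose A *v (A *v z)"] by (simp add: dot W_def orthogonal_def)
    then have "A *v w = p" by (simp add: u uwz matrix_vector_right_distrib)
    then show ?thesis using w q y by (intro bexI[of _ w]) (auto simp: orthogonal_def)
  qed
  have uniq: "w = w'"
    if "w \<in> W" "w' \<in> W" "\<forall>v. (y - A *v w) \<bullet> (A *v v) = 0" "\<forall>v. (y - A *v w') \<bullet> (A *v v) = 0"
    for y w w'
  proof -
    have "(A *v (w - w')) \<bullet> (A *v (w - w')) = 0"
      using that(3)[rule_format, of "w - w'"] that(4)[rule_format, of "w - w'"]
      by (simp add: matrix_vector_mult_diff_distrib inner_diff_left)
    then have "A *v (w - w') = 0" by simp
    moreover have "w - w' \<in> W" using that W by (simp add: subspace_diff)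
    ultimately have "(w - w') \<bullet> (w - w') = 0" using ker by blast
    then show ?thesis by simp
  qed
  obtain f where fW: "f y \<in> W" and f: "(y - A *v f y) \<bullet> (A *v v) = 0" for y v
    using ex by metis
  have "linear f"
  proof (rule linearI)
    show "f (x + y) = f x + f y" for x y
      using f[of x] f[of y] f[of "x + y"]
      by (intro uniq[of _ _ "x + y"])
         (auto simp: fW f subspace_add[OF W] matrix_vector_right_distrib inner_add_left inner_diff_left)
    show "f (c *\<^sub>R x) = c *\<^sub>R f x" for c x
      using f[of x] f[of "c *\<^sub>R x"]
      by (intro uniq[of _ _ "c *\<^sub>R x"])
         (auto simp: fW f subspace_scale[OF W] matrix_vector_mult_scaleR inner_diff_left)
  qed
  then have X: "matrix f *v y = f y" for y by (simp add: matrix_works)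
  have AfA: "A *v f (A *v x) = A *v x" for x
  proof -
    have "(A *v x - A *v f (A *v x)) \<bullet> (A *v (x - f (A *v x))) = 0" by (rule f)
    then show ?thesis by (simp add: matrix_vector_mult_diff_distrib)
  qed
  have fAf: "f (A *v f y) = f y" for y
    by (rule uniq[of _ _ "A *v f y"]) (auto simp: fW AfA)
  have Af: "(A *v f x) \<bullet> y = (A *v f x) \<bullet> (A *v f y)" for x y
    using f[of y "f x"] by (simp add: inner_diff_left inner_diff_right inner_commute)
  have fA: "f (A *v x) \<bullet> y = f (A *v x) \<bullet> f (A *v y)" for x y
    using ker[OF fW, of "y - f (A *v y)" "A *v x"]
    by (simp add: AfA matrix_vector_mult_diff_distrib inner_diff_right)
  have "is_moore_penrose A (matrix f)"
    unfolding is_moore_penrose_def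
  proof (intro conjI)
    show "A ** matrix f ** A = A"
      by (simp add: matrix_eq X AfA flip: matrix_vector_mul_assoc)
    show "matrix f ** A ** matrix f = matrix f"
      by (simp add: matrix_eq X fAf flip: matrix_vector_mul_assoc)
    show "transpose (A ** matrix f) = A ** matrix f"
      by (rule symmetric_matrixI) (metis Af X inner_commute matrix_vector_mul_assoc)
    show "transpose (matrix f ** A) = matrix f ** A"
      by (rule symmetric_matrixI) (metis fA X inner_commute matrix_vector_mul_assoc)
  qed
  then show ?thesis by blast
qed

theorem moore_penrose_unique: "\<exists>!X. is_moore_penrose A X"
  using is_moore_penrose_exists is_moore_penrose_eq by blast

lemma is_moore_penrose_pinv: "is_moore_penrose A (pinv A)"
  unfolding pinv_def by (rule theI'[OF moore_penrose_unique])

end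

theory Submission
  imports Defs
begin

text \<open>Write \<open>D = a\<^sup>2 l 1' + b\<^sup>2 1 l' - 2 a b L\<close> with \<open>l\<close> the diagonal of \<open>L\<close>. Put \<open>y = D\<^sup>\<dagger> x\<close>; the
  residual \<open>z = x - D y\<close> lies in the kernel of \<open>D'\<close>. This kernel is contained in the kernel of \<open>D\<close> and,
  unless \<open>l = 0\<close>, is orthogonal to \<open>1\<close>. As \<open>y\<close> lies in the range of \<open>D'\<close>, it is orthogonal to \<open>z\<close>, so
  \<open>x' D\<^sup>\<dagger> x = y' D y\<close>, while \<open>1' x = 0\<close> gives \<open>1' D y = 0\<close>. The latter fixes the ratio of \<open>l' y\<close> to
  \<open>1' y\<close> and makes \<open>y' D y\<close> a sum of nonpositive terms.\<close>

lemma positive_semidefinite_diagonal_nonneg: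
  assumes "positive_semidefinite A"
  shows "0 \<le> A $ i $ i"
proof -
  have "axis i 1 \<bullet> (A *v axis i 1) = A $ i $ i"
    by (simp add: inner_axis' matrix_vector_mul_component inner_axis)
  then show ?thesis
    using assms unfolding positive_semidefinite_def by metis
qed

lemma inner_symmetric_matrix:
  fixes A :: "real^'n^'n"
  assumes "transpose A = A"
  shows "x \<bullet> (A *v y) = y \<bullet> (A *v x)"
  by (metis assms dot_lmul_matrix inner_commute transpose_matrix_vector)

text \<open>Later arguments only test \<open>D\<close> against vectors. For a Laplacian
  \<open>L\<close>, putting \<open>1\<close> on either side kills the last term, while
  \<open>x = y\<close> leaves a quadratic form of known sign.\<close>

lemma inner_distance_matrix:
  fixes D L :: "real^'n^'n" and a b :: real
  assumes "\<And>i j. D $ i $ j = a\<^sup>2 * L $ i $ i + b\<^sup>2 * L $ j $ j - 2 * a * b * L $ i $ j"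
  defines "l \<equiv> \<chi> i. L $ i $ i"
  shows "x \<bullet> (D *v y) =
    a\<^sup>2 * (l \<bullet> x) * (1 \<bullet> y) + b\<^sup>2 * (1 \<bullet> x) * (l \<bullet> y) - 2 * a * b * (x \<bullet> (L *v y))"
proof -
  have "(D *v y) $ i = a\<^sup>2 * l $ i * (1 \<bullet> y) + b\<^sup>2 * (l \<bullet> y) - 2 * a * b * (L *v y) $ i" for i
    by (simp add: matrix_vector_mult_def assms(1) l_def inner_vec_def sum_distrib_left
        sum_distrib_right sum.distrib sum_subtractf algebra_simps)
  then have "D *v y = (a\<^sup>2 * (1 \<bullet> y)) *\<^sub>R l + (b\<^sup>2 * (l \<bullet> y)) *\<^sub>R 1 - (2 * a * b) *\<^sub>R (L *v y)"
    by (simp add: vec_eq_iff)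
  then show ?thesis
    by (simp add: inner_add_right inner_diff_right inner_commute[of x l] inner_commute[of x 1])
qed

locale generalized_distance =
  fixes D L :: "real^'n^'n" and a b :: real and l :: "real^'n"
  assumes a: "a > 0" and b: "b > 0" and laplacian: "generalized_laplacian L"
    and entry: "\<And>i j. D $ i $ j = a\<^sup>2 * L $ i $ i + b\<^sup>2 * L $ j $ j - 2 * a * b * L $ i $ j"
  defines "l \<equiv> \<chi> i. L $ i $ i"
begin

lemmas inner_D = inner_distance_matrix[OF entry, folded l_def]

lemma L_sym: "x \<bullet> (L *v y) = y \<bullet> (L *v x)"
  using laplacian by (intro inner_symmetric_matrix) (simp add: generalized_laplacian_def)

lemma L_nonneg: "0 \<le> x \<bullet> (L *v x)"
  using laplacian by (simp add: generalized_laplacian_def positive_semidefinite_def)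

lemma L_one: "L *v 1 = 0"
  using laplacian by (simp add: generalized_laplacian_def)

lemma inner_one_L: "1 \<bullet> (L *v x) = 0"
  using L_sym[of 1 x] by (simp add: L_one)

lemma one_inner_one: "(1::real^'n) \<bullet> 1 > 0"
  by (simp add: inner_vec_def)

lemma diagonal_nonneg: "0 \<le> l $ i"
  using laplacian positive_semidefinite_diagonal_nonneg
  by (auto simp: l_def generalized_laplacian_def)

lemma trace_nonneg: "0 \<le> l \<bullet> 1"
  by (simp add: inner_vec_def sum_nonneg diagonal_nonneg)

lemma trace_eq_0_iff: "l \<bullet> 1 = 0 \<longleftrightarrow> l = 0"
  by (simp add: inner_vec_def sum_nonneg_eq_0_iff diagonal_nonneg vec_eq_iff)

text \<open>The hypothesis reads \<open>a\<^sup>2 * t * s + b\<^sup>2 * n * m = 0\<close> with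
  \<open>t \<ge> 0\<close> and \<open>n > 0\<close>, so \<open>s * m \<le> 0\<close>. Both terms of
  \<open>(a\<^sup>2 + b\<^sup>2) * (s * m) - 2 * a * b * (y \<bullet> (L *v y))\<close> are then
  nonpositive.\<close>

lemma quadratic_form_nonpos:
  assumes "1 \<bullet> (D *v y) = 0"
  shows "y \<bullet> (D *v y) \<le> 0"
proof -
  define n t s m where "n = (1::real^'n) \<bullet> 1" and "t = l \<bullet> 1" and "s = 1 \<bullet> y" and "m = l \<bullet> y"
  have n: "n > 0" and t: "t \<ge> 0"
    using one_inner_one trace_nonneg by (auto simp: n_def t_def)
  have m: "b\<^sup>2 * n * m = - (a\<^sup>2 * t * s)"
    using assms by (simp add: inner_D inner_one_L n_def t_def s_def m_def)
  \<comment> \<open>Multiplying by \<open>s\<close>, rather than dividing, also covers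
    \<open>s = 0\<close>.\<close>
  have "(b\<^sup>2 * n) * (s * m) = - (a\<^sup>2 * t * s\<^sup>2)"
    using arg_cong[OF m, of "(*) s"] by (simp add: power2_eq_square algebra_simps)
  also have "\<dots> \<le> 0" using t by simp
  finally have "s * m \<le> 0"
    using n b mult_le_cancel_left_pos[of "b\<^sup>2 * n" "s * m" 0] by simp
  then have "(a\<^sup>2 + b\<^sup>2) * (s * m) \<le> 0"
    by (rule mult_nonneg_nonpos[rotated]) simp
  moreover have "0 \<le> a * b * (y \<bullet> (L *v y))"
    using a b L_nonneg by simp
  ultimately show ?thesis
    by (simp add: inner_D s_def m_def algebra_simps)
qed

text \<open>Two test vectors conflict: \<open>w = 1\<close> forces \<open>s * m \<le> 0\<close>, and
  \<open>w = z\<close> forces \<open>s * m \<ge> 0\<close>. As \<open>l \<noteq> 0\<close> makes the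
  trace \<open>t\<close> positive, this leaves \<open>s = 0\<close>, and then
  \<open>m = 0\<close>.\<close>

lemma left_kernel_orthogonal:
  assumes z: "\<And>w. z \<bullet> (D *v w) = 0" and "l \<noteq> 0"
  shows "1 \<bullet> z = 0" "l \<bullet> z = 0"
proof -
  define n t s m where "n = (1::real^'n) \<bullet> 1" and "t = l \<bullet> 1" and "s = 1 \<bullet> z" and "m = l \<bullet> z"
  have n: "n > 0" and t: "t > 0"
    using one_inner_one trace_nonneg trace_eq_0_iff \<open>l \<noteq> 0\<close> by (auto simp: n_def t_def less_le)
  have m: "a\<^sup>2 * n * m = - (b\<^sup>2 * t * s)"
    using z[of 1] by (simp add: inner_D L_one n_def t_def s_def m_def algebra_simps)
  have "(a\<^sup>2 + b\<^sup>2) * (s * m) = 2 * a * b * (z \<bullet> (L *v z))"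
    using z[of z] by (simp add: inner_D s_def m_def algebra_simps)
  also have "\<dots> \<ge> 0"
    using a b L_nonneg by simp
  finally have "0 \<le> s * m"
    using a b mult_le_cancel_left_pos[of "a\<^sup>2 + b\<^sup>2" 0 "s * m"] by (simp add: add_pos_pos)
  then have "0 \<le> (a\<^sup>2 * n) * (s * m)"
    using n by simp
  also have "\<dots> = - (b\<^sup>2 * t * s\<^sup>2)"
    using arg_cong[OF m, of "(*) s"] by (simp add: power2_eq_square algebra_simps)
  finally have "b\<^sup>2 * t * s\<^sup>2 \<le> 0" by simp
  then have s: "s = 0"
    using b t by (simp add: mult_le_0_iff)
  then show "1 \<bullet> z = 0" by (simp add: s_def)
  show "l \<bullet> z = 0"
    using m a n s by (simp add: m_def)
qed

text \<open>On such \<open>z\<close> the two rank-one terms of \<open>D\<close> vanish from either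
  side, and the remaining multiple of \<open>L\<close> is symmetric.\<close>

lemma left_kernel_subset_kernel:
  assumes z: "\<And>w. z \<bullet> (D *v w) = 0"
  shows "D *v z = 0"
proof -
  have "w \<bullet> (D *v z) = 0" for w
  proof (cases "l = 0")
    case True
    then show ?thesis
      using z[of w] L_sym[of z w] by (simp add: inner_D)
  next
    case False
    then show ?thesis
      using z[of w] L_sym[of z w] left_kernel_orthogonal[OF z] by (simp add: inner_D)
  qed
  then show ?thesis
    using vector_eq_ldot[of "D *v z" 0] by simp
qed

lemma pinv_nonpos:
  assumes x: "1 \<bullet> x = 0"
  shows "x \<bullet> (pinv D *v x) \<le> 0"
proof -
  note mp = is_moore_penrose_pinv[of D, unfolded is_moore_penrose_def]
  define y z where "y = pinv D *v x" and "z = x - D *v y"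
  \<comment> \<open>\<open>D ** pinv D\<close> is the orthogonal projector onto the range of
    \<open>D\<close>, and \<open>z\<close> is the part of \<open>x\<close> that it removes.\<close>
  have "z \<bullet> (D *v w) = 0" for w
  proof -
    have "(D *v y) \<bullet> (D *v w) = (D *v w) \<bullet> ((D ** pinv D) *v x)"
      by (simp add: y_def inner_commute matrix_vector_mul_assoc)
    also have "\<dots> = x \<bullet> ((D ** pinv D) *v (D *v w))"
      using mp by (intro inner_symmetric_matrix) simp
    also have "\<dots> = x \<bullet> (D *v w)"
      using mp by (simp add: matrix_vector_mul_assoc)
    finally show ?thesis by (simp add: z_def inner_diff_left)
  qed
  note z = this
  have Dz: "D *v z = 0"
    by (rule left_kernel_subset_kernel[OF z])
  \<comment> \<open>The symmetric projector \<open>pinv D ** D\<close> fixes \<open>y\<close> and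
    annihilates \<open>z\<close>.\<close>
  have "z \<bullet> y = z \<bullet> ((pinv D ** D) *v y)"
    using mp by (simp add: y_def matrix_vector_mul_assoc)
  also have "\<dots> = y \<bullet> ((pinv D ** D) *v z)"
    using mp by (intro inner_symmetric_matrix) simp
  also have "\<dots> = 0"
    by (simp add: Dz flip: matrix_vector_mul_assoc)
  finally have "x \<bullet> y = y \<bullet> (D *v y)"
    by (simp add: z_def inner_diff_left inner_commute[of "D *v y"])
  also have "\<dots> \<le> 0"
  \<comment> \<open>Orthogonality of \<open>z\<close> to \<open>1\<close> is available only for
    \<open>l \<noteq> 0\<close>. Otherwise \<open>D\<close> is \<open>- 2 * a * b\<close> times
    \<open>L\<close>, and the sign is immediate.\<close>
  proof (cases "l = 0")
    case True
    then show ?thesis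
      using a b L_nonneg[of y] by (simp add: inner_D)
  next
    case False
    then have "1 \<bullet> (D *v y) = 0"
      using left_kernel_orthogonal(1)[OF z] x by (simp add: z_def inner_diff_right)
    then show ?thesis by (rule quadratic_form_nonpos)
  qed
  finally show ?thesis by (simp add: y_def)
qed

end

theorem corollary2p14:
  fixes D :: "real^'n^'n"
  assumes "generalized_euclidean_distance_matrix D"
    and "D \<noteq> 0"
  shows "\<forall>x::real^'n. 1 \<bullet> x = 0 \<longrightarrow> x \<bullet> (pinv D *v x) \<le> 0"
proof -
  obtain a b L where "generalized_distance D L a b"
    using assms(1) unfolding generalized_euclidean_distance_matrix_def generalized_distance_def
    by blast
  then show ?thesis
    using generalized_distance.pinv_nonpos by blast
qed

end
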